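(* Let $k\ge 1$ be an integer and let $M$ be an even integer. Consider the New Amsterdam digraph $N\!A(M;\alpha,\beta,\gamma,\delta)$ with steps $$\beta=-\alpha=1,\qquad \gamma=-\delta=2k+1,$$ i.e. the digraph with vertex set $\mathbb{Z}_M$ in which every even vertex $i$ has arcs to $i-1$ and $i+1$, and every odd vertex $j$ has arcs to $j+2k+1$ and $j-2k-1$ (arithmetic modulo $M$). Let $D$ denote its diameter. Then: (a) if $4k^2+4\le M\le 4k^2+4k+2$, then $D=2k+1$; (b) if $M=4k^2+4k+4$, then $D=2k+2$; (c) if $4k^2+4k+8\le M\le 4(k+1)^2+2$, then $D=2k+3$.
   Context: A New Amsterdam digraph $N\!A(M;\alpha,\beta,\gamma,\delta)$, for even $M$ and odd integers $\alpha\neq\beta,\gamma,\delta$ with $\alpha+\beta+\gamma+\delta\equiv 0 \pmod M$, is the bipartite digraph on $\mathbb{Z}_M$ where each even vertex $i$ has arcs to $i+\alpha,i+\beta$ and each odd vertex $j$ has arcs to $j+\gamma,j+\delta$ (mod $M$). The diameter of a digraph is the maximum, over ordered pairs of vertices $(u,v)$, of the length of a shortest directed path from $u$ to $v$. *)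

theory Defs
  imports
    "Graph_Theory.Graph_Theory"
    "HOL-Library.Extended_Nat"
    "HOL-Number_Theory.Cong"
begin

text \<open>
  A directed path is an \<open>apath\<close> (a walk, given by its list of arcs, without repeated vertices).
  Distances are extended naturals: unreachable pairs are at distance \<open>\<infinity>\<close>,
  so a finite diameter includes strong connectivity.
\<close>

definition digraph_dist :: "('a, 'b) pre_digraph \<Rightarrow> 'a \<Rightarrow> 'a \<Rightarrow> enat" where
  "digraph_dist G u v = (INF p \<in> {p. pre_digraph.apath G u p v}. enat (length p))"

definition digraph_diameter :: "('a, 'b) pre_digraph \<Rightarrow> enat" where
  "digraph_diameter G = (SUP (u, v) \<in> verts G \<times> verts G. digraph_dist G u v)"

text \<open>
  The vertices are the least nonnegative residues modulo \<open>M\<close>; an arc is the pair of its end points.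
  The parity of a residue class is well defined only for even \<open>M\<close>.
\<close>

definition new_amsterdam ::
    "nat \<Rightarrow> int \<Rightarrow> int \<Rightarrow> int \<Rightarrow> int \<Rightarrow> (int, int \<times> int) pre_digraph" where
  "new_amsterdam M \<alpha> \<beta> \<gamma> \<delta> =
    \<lparr> verts = {0..<int M},
      arcs = {(i, (i + s) mod int M) | i s.
               i \<in> {0..<int M} \<and> (if even i then s \<in> {\<alpha>, \<beta>} else s \<in> {\<gamma>, \<delta>})},
      tail = fst,
      head = snd \<rparr>"

definition new_amsterdam_steps :: "nat \<Rightarrow> int \<Rightarrow> int \<Rightarrow> int \<Rightarrow> int \<Rightarrow> bool" where
  "new_amsterdam_steps M \<alpha> \<beta> \<gamma> \<delta> \<longleftrightarrow>
    even M \<and> odd \<alpha> \<and> odd \<beta> \<and> odd \<gamma> \<and> odd \<delta> \<and> \<alpha> \<noteq> \<beta> \<and> \<gamma> \<noteq> \<delta> \<and>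
    [\<alpha> + \<beta> + \<gamma> + \<delta> = 0] (mod int M)"

lemma new_amsterdam_steps_special:
  "even M \<Longrightarrow> new_amsterdam_steps M (- 1) 1 (2 * int k + 1) (- (2 * int k + 1))"
  unfolding new_amsterdam_steps_def by simp

lemma wf_digraph_new_amsterdam: "wf_digraph (new_amsterdam M \<alpha> \<beta> \<gamma> \<delta>)"
  by unfold_locales (auto simp: new_amsterdam_def)

end

theory Submission
  imports Defs
begin

text \<open>
  Write \<open>g = 2k + 1\<close>. Walks alternate between steps \<open>\<plusminus>1\<close> and \<open>\<plusminus>g\<close>, so in \<open>2a\<close> steps one
  realises exactly the displacements \<open>x + g y\<close> with \<open>\<bar>x\<bar>, \<bar>y\<bar> \<le> a\<close> and \<open>x \<equiv> y \<equiv> a\<close> modulo 2.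
  Division by \<open>g\<close> with a remainder in \<open>[-k, k]\<close> shows that the even numbers of absolute
  value at most \<open>2k(k + 1)\<close> are precisely those realised with some \<open>a \<le> k\<close>. One more
  step reduces odd displacements to even ones, which gives the upper bounds. For the lower bounds,
  \<open>n\<close> steps from 0 change the position by at most \<open>\<lceil>n/2\<rceil> + g \<lfloor>n/2\<rfloor>\<close>, and the parity of the
  displacement is that of \<open>n\<close>.
\<close>

section \<open>Walks, their lengths, and distances\<close>

text \<open>Cutting out cycles only removes arcs. Distances are defined by paths, so this lets any
  walk bound a distance from above.\<close>

lemma (in wf_digraph) length_awalk_to_apath_le:
  assumes "awalk u p v"
  shows "length (awalk_to_apath p) \<le> length p"
  using assms
proof (induct rule: awalk_to_apath_induct)
  case (path p)
  then have "awalk_to_apath p = p" by (auto simp: awalk_to_apath.simps)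
  then show ?case by simp
next
  case (decomp p q r s)
  then show ?case 
    using step_awalk_to_apath[of u p v q r s] awalk_cyc_decomp_has_prop[of u p v] by auto
qed

text \<open>End points are arbitrary integers, reduced only inside the definition, so displacements
  add in \<open>int\<close> without wraparound cases. Walks rather than paths allow arcs to be
  prepended freely.\<close>

definition mod_reach :: "nat \<Rightarrow> int \<Rightarrow> int \<Rightarrow> int \<Rightarrow> int \<Rightarrow> nat \<Rightarrow> int \<Rightarrow> int \<Rightarrow> bool" where
  "mod_reach M \<alpha> \<beta> \<gamma> \<delta> n i j \<longleftrightarrow>
    (\<exists>p. pre_digraph.awalk (new_amsterdam M \<alpha> \<beta> \<gamma> \<delta>) (i mod int M) p (j mod int M) \<and> length p = n)"

lemma mod_reach_refl:
  assumes "M > 0"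
  shows "mod_reach M \<alpha> \<beta> \<gamma> \<delta> 0 i i"
proof -
  interpret wf_digraph "new_amsterdam M \<alpha> \<beta> \<gamma> \<delta>" by (rule wf_digraph_new_amsterdam)
  show ?thesis
    using assms by (simp add: mod_reach_def awalk_Nil_iff) (simp add: new_amsterdam_def)
qed

lemma mod_reach_Suc:
  assumes "M > 0" "even M" "if even i then s \<in> {\<alpha>, \<beta>} else s \<in> {\<gamma>, \<delta>}"
    and "mod_reach M \<alpha> \<beta> \<gamma> \<delta> n (i + s) j"
  shows "mod_reach M \<alpha> \<beta> \<gamma> \<delta> (Suc n) i j"
proof -
  interpret wf_digraph "new_amsterdam M \<alpha> \<beta> \<gamma> \<delta>" by (rule wf_digraph_new_amsterdam)
  let ?G = "new_amsterdam M \<alpha> \<beta> \<gamma> \<delta>"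
  obtain p where p: "awalk ((i + s) mod int M) p (j mod int M)" "length p = n"
    using assms(4) by (auto simp: mod_reach_def)
  have par: "even (i mod int M) \<longleftrightarrow> even i"
    using assms(2) by (simp add: dvd_mod_iff)
  have "(i mod int M, (i mod int M + s) mod int M) \<in> arcs ?G"
    unfolding new_amsterdam_def
    using assms(1,3) par by (auto split: if_splits)
  then have "(i mod int M, (i + s) mod int M) \<in> arcs ?G"
    by (simp add: mod_add_left_eq)
  then have "awalk (i mod int M) ((i mod int M, (i + s) mod int M) # p) (j mod int M)"
    using p(1) by (simp add: awalk_Cons_iff) (simp add: new_amsterdam_def)
  with p(2) show ?thesis
    unfolding mod_reach_def by (metis length_Cons)
qed

lemma digraph_dist_le_mod_reach:
  assumes "mod_reach M \<alpha> \<beta> \<gamma> \<delta> n i j"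
  shows "digraph_dist (new_amsterdam M \<alpha> \<beta> \<gamma> \<delta>) (i mod int M) (j mod int M) \<le> enat n"
proof -
  interpret wf_digraph "new_amsterdam M \<alpha> \<beta> \<gamma> \<delta>" by (rule wf_digraph_new_amsterdam)
  obtain p where p: "awalk (i mod int M) p (j mod int M)" "length p = n"
    using assms by (auto simp: mod_reach_def)
  have "apath (i mod int M) (awalk_to_apath p) (j mod int M)"
    using p(1) by (rule apath_awalk_to_apath)
  moreover have "length (awalk_to_apath p) \<le> n"
    using length_awalk_to_apath_le[OF p(1)] p(2) by simp
  ultimately show ?thesis
    unfolding digraph_dist_def by (intro INF_lower2[where i = "awalk_to_apath p"]) auto
qed

section \<open>Even displacements realised by walks\<close>

text \<open>A unit step towards 0 lowers the absolute value. At \<open>x = 0\<close> parity makes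
  \<open>Suc a\<close> even, so \<open>a\<close> is at least 1 and leaves room for a step away from
  0.\<close>

lemma abs_pred_sign:
  fixes x :: int
  assumes "\<bar>x\<bar> \<le> int (Suc a)" "even (x - int (Suc a))"
  obtains s where "s = 1 \<or> s = -1" "\<bar>x - s\<bar> \<le> int a" "even (x - s - int a)"
proof (cases "x > 0")
  case True
  then show ?thesis using assms that[of 1] by auto
next
  case False
  have par: "even (x - (-1) - int a)" using assms(2) by simp
  show ?thesis
  proof (cases "x = 0 \<and> a = 0")
    case True
    then show ?thesis using assms by simp
  next
    case F: False
    then have "\<bar>x - (-1)\<bar> \<le> int a" using assms False by auto
    then show ?thesis using that[of "-1"] par by blast
  qed
qed

text \<open>Two consecutive arcs consist of one step \<plusminus>1 and one step \<plusminus>g, in an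
  order fixed by the parity of \<open>i\<close>. The induction therefore peels one sign off
  \<open>x\<close> and one off \<open>y\<close> at a time.\<close>

lemma mod_reach_even:
  fixes g x y :: int
  assumes M: "M > 0" "even M" and g: "odd g"
  shows "\<bar>x\<bar> \<le> int a \<Longrightarrow> even (x - int a) \<Longrightarrow> \<bar>y\<bar> \<le> int a \<Longrightarrow> even (y - int a) \<Longrightarrow>
    mod_reach M (-1) 1 g (-g) (2 * a) i (i + x + g * y)"
proof (induction a arbitrary: x y i)
  case 0
  then show ?case using mod_reach_refl[OF M(1)] by simp
next
  case (Suc a)
  obtain s where s: "s = 1 \<or> s = -1" "\<bar>x - s\<bar> \<le> int a" "even (x - s - int a)"
    using abs_pred_sign Suc.prems(1,2) by blast
  obtain r where r: "r = 1 \<or> r = -1" "\<bar>y - r\<bar> \<le> int a" "even (y - r - int a)"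
    using abs_pred_sign Suc.prems(3,4) by blast
  have IH: "mod_reach M (-1) 1 g (-g) (2 * a) (i + s + g * r) (i + x + g * y)"
    using Suc.IH[OF s(2,3) r(2,3), of "i + s + g * r"] by (simp add: algebra_simps)
  have "mod_reach M (-1) 1 g (-g) (Suc (Suc (2 * a))) i (i + x + g * y)"
  proof (cases "even i")
    case True
    have "mod_reach M (-1) 1 g (-g) (Suc (2 * a)) (i + s) (i + x + g * y)"
      by (rule mod_reach_Suc[OF M _ IH]) (use True s(1) r(1) in auto)
    then show ?thesis
      by (rule mod_reach_Suc[OF M, rotated]) (use True s(1) in auto)
  next
    case False
    have IH': "mod_reach M (-1) 1 g (-g) (2 * a) (i + g * r + s) (i + x + g * y)"
      using IH by (simp add: algebra_simps)
    have "mod_reach M (-1) 1 g (-g) (Suc (2 * a)) (i + g * r) (i + x + g * y)"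
      by (rule mod_reach_Suc[OF M _ IH']) (use False s(1) r(1) g in auto)
    then show ?thesis
      by (rule mod_reach_Suc[OF M, rotated]) (use False r(1) in auto)
  qed
  then show ?case by simp
qed

lemma even_displacement_le:
  fixes k :: nat and t :: int
  assumes "even t" "\<bar>t\<bar> \<le> 2 * int k * (int k + 1)"
  obtains a x y where "a \<le> k" "\<bar>x\<bar> \<le> int a" "even (x - int a)" "\<bar>y\<bar> \<le> int a" "even (y - int a)"
    "t = x + (2 * int k + 1) * y"
proof -
  define g where "g = 2 * int k + 1"
  define y where "y = (t + int k) div g"
  define x where "x = (t + int k) mod g - int k"
  have g: "g > 0" "odd g" by (auto simp: g_def)
  have t: "t = x + g * y"
    using mult_div_mod_eq[of g "t + int k"] unfolding x_def y_def by linarith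
  have xk: "\<bar>x\<bar> \<le> int k"
    using pos_mod_bound[OF g(1), of "t + int k"] pos_mod_sign[OF g(1), of "t + int k"]
    unfolding x_def g_def by linarith
  \<comment> \<open>The bound is tight: \<open>2k(k + 1) + k\<close> is one less than
    \<open>g(k + 1)\<close>.\<close>
  have "g * y < g * (int k + 1)"
  proof -
    have "g * y \<le> t + int k" using t xk by linarith
    also have "\<dots> < g * (int k + 1)" using assms(2) by (simp add: g_def algebra_simps)
    finally show ?thesis .
  qed
  then have y1: "y \<le> int k" using g(1) by simp
  have "g * (- int k - 1) < g * y"
  proof -
    have "g * (- int k - 1) < t - int k" using assms(2) by (simp add: g_def algebra_simps)
    also have "\<dots> \<le> g * y" using t xk by linarith
    finally show ?thesis .
  qed
  then have y2: "- int k \<le> y" using g(1) by simp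
  have par: "even x \<longleftrightarrow> even y" using t assms(1) g(2) by auto
  show ?thesis
  proof (cases "even (x - int k)")
    case True
    then show ?thesis
      using that[of k x y] xk y1 y2 par t by (auto simp: g_def)
  next
    case False
    \<comment> \<open>\<open>x\<close> and \<open>y\<close> share a parity, here opposite to that of
      \<open>k\<close>, so neither attains \<plusminus>k and \<open>a = k - 1\<close>
      suffices.\<close>
    then have "x \<noteq> int k" "x \<noteq> - int k" "y \<noteq> int k" "y \<noteq> - int k" using par by auto
    then have b: "\<bar>x\<bar> \<le> int (k - 1)" "\<bar>y\<bar> \<le> int (k - 1)" using xk y1 y2 by auto
    have "k > 0" using False xk by (cases k) auto
    then have "even (x - int (k - 1))" "even (y - int (k - 1))"
      using False par by (auto simp: of_nat_diff)
    with b show ?thesis using that[of "k - 1" x y] t by (auto simp: g_def)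
  qed
qed

text \<open>Beyond the range of the previous lemma, the coefficient of \<open>g\<close> can be fixed
  at \<open>k + 1\<close> up to the sign of \<open>t\<close>: the rest of
  \<open>\<bar>t\<bar>\<close> then lies in \<open>[-k, k + 1]\<close> and has the parity of
  \<open>k + 1\<close>.\<close>

lemma even_displacement_Suc_le:
  fixes k :: nat and t :: int
  assumes "even t" "\<bar>t\<bar> \<le> 2 * (int k + 1)\<^sup>2"
  obtains a x y where "a \<le> Suc k" "\<bar>x\<bar> \<le> int a" "even (x - int a)" "\<bar>y\<bar> \<le> int a"
    "even (y - int a)" "t = x + (2 * int k + 1) * y"
proof (cases "\<bar>t\<bar> \<le> 2 * int k * (int k + 1)")
  case True
  then show ?thesis using even_displacement_le[OF assms(1) True] that le_SucI by metis
next
  case False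
  define x where "x = \<bar>t\<bar> - (2 * int k + 1) * (int k + 1)"
  have "\<bar>x\<bar> \<le> int (Suc k)"
    using False assms(2) by (auto simp: x_def power2_eq_square algebra_simps)
  moreover have "even (x - int (Suc k))" using assms(1) by (auto simp: x_def)
  moreover have "t = sgn t * x + (2 * int k + 1) * (sgn t * (int k + 1))"
    by (auto simp: x_def sgn_if algebra_simps)
  moreover have "\<bar>sgn t\<bar> = 1" using False by (auto simp: sgn_if split: if_splits)
  ultimately show ?thesis
    by (intro that[of "Suc k" "sgn t * x" "sgn t * (int k + 1)"])
       (auto simp: abs_mult sgn_if split: if_splits)
qed

section \<open>Centred residues modulo \<open>M\<close>\<close>

lemma centered_residue:
  fixes t :: int
  assumes "M > 0"
  obtains r where "[t = r] (mod int M)" "2 * \<bar>r\<bar> \<le> int M"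
proof -
  define r where "r = (if 2 * (t mod int M) \<le> int M then t mod int M else t mod int M - int M)"
  have "0 \<le> t mod int M" "t mod int M < int M" using assms by auto
  then have "2 * \<bar>r\<bar> \<le> int M" by (auto simp: r_def)
  moreover have "[t = r] (mod int M)" by (auto simp: r_def cong_def)
  ultimately show ?thesis using that by blast
qed

lemma mod_reach_cong:
  assumes "[j = j'] (mod int M)"
  shows "mod_reach M \<alpha> \<beta> \<gamma> \<delta> n i j \<longleftrightarrow> mod_reach M \<alpha> \<beta> \<gamma> \<delta> n i j'"
  using assms by (simp add: mod_reach_def cong_def)

section \<open>How far a walk can move\<close>

text \<open>\<open>z\<close> is the sum of the steps taken, before reduction. All steps are odd,
  which gives its parity; the parity of \<open>u\<close> decides whether the \<plusminus>1 or the
  \<plusminus>g steps get the extra one when the length is odd.\<close>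

lemma awalk_displacement_bound:
  fixes g :: int
  assumes "even M" "odd g" "g \<ge> 1"
  shows "pre_digraph.awalk (new_amsterdam M (-1) 1 g (-g)) u p v \<Longrightarrow>
    \<exists>z. [v = u + z] (mod int M) \<and> (even z \<longleftrightarrow> even (length p)) \<and>
      \<bar>z\<bar> \<le> (if even u then int ((length p + 1) div 2) + g * int (length p div 2)
               else int (length p div 2) + g * int ((length p + 1) div 2))"
proof (induction p arbitrary: u)
  interpret wf_digraph "new_amsterdam M (-1) 1 g (-g)" by (rule wf_digraph_new_amsterdam)
  case Nil
  then show ?case by (intro exI[of _ 0]) (auto simp: awalk_Nil_iff)
next
  let ?G = "new_amsterdam M (-1) 1 g (-g)"
  interpret wf_digraph ?G by (rule wf_digraph_new_amsterdam)
  case (Cons e p)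
  obtain s where s: "if even u then s \<in> {-1, 1} else s \<in> {g, -g}"
    and w: "awalk ((u + s) mod int M) p v"
  proof -
    have e: "e \<in> arcs ?G" "u = tail ?G e" "awalk (head ?G e) p v"
      using Cons.prems by (auto simp: awalk_Cons_iff)
    from e(1,2) obtain s where "if even u then s \<in> {-1, 1} else s \<in> {g, -g}"
      "head ?G e = (u + s) mod int M"
      by (auto simp: new_amsterdam_def)
    with e(3) that show ?thesis by metis
  qed
  have par: "even ((u + s) mod int M) \<longleftrightarrow> odd u"
    using s assms(1,2) by (auto simp: dvd_mod_iff split: if_splits)
  obtain z where z: "[v = (u + s) mod int M + z] (mod int M)" "even z \<longleftrightarrow> even (length p)"
    "\<bar>z\<bar> \<le> (if odd u then int ((length p + 1) div 2) + g * int (length p div 2)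
               else int (length p div 2) + g * int ((length p + 1) div 2))"
    using Cons.IH[OF w] unfolding par by blast
  have "[v = u + (s + z)] (mod int M)"
    using z(1) by (simp add: cong_def mod_simps add.assoc)
  moreover have "even (s + z) \<longleftrightarrow> even (length (e # p))"
    using z(2) s assms(2) by (auto split: if_splits)
  moreover have "\<bar>s + z\<bar> \<le> (if even u then int ((length (e # p) + 1) div 2) + g * int (length (e # p) div 2)
               else int (length (e # p) div 2) + g * int ((length (e # p) + 1) div 2))"
    using z(3) s assms(3) by (auto simp: algebra_simps split: if_splits)
  ultimately show ?case by blast
qed


section \<open>Criteria for bounding the diameter\<close>

lemma digraph_diameter_le_mod_reach:
  assumes "\<And>i t. \<exists>n\<le>N. mod_reach M \<alpha> \<beta> \<gamma> \<delta> n i (i + t)"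
  shows "digraph_diameter (new_amsterdam M \<alpha> \<beta> \<gamma> \<delta>) \<le> enat N"
  unfolding digraph_diameter_def
proof (rule SUP_least, clarify)
  fix u v
  assume uv: "u \<in> verts (new_amsterdam M \<alpha> \<beta> \<gamma> \<delta>)" "v \<in> verts (new_amsterdam M \<alpha> \<beta> \<gamma> \<delta>)"
  then have uv: "u mod int M = u" "v mod int M = v" by (auto simp: new_amsterdam_def)
  obtain n where "n \<le> N" "mod_reach M \<alpha> \<beta> \<gamma> \<delta> n u v"
    using assms[of u "v - u"] by auto
  then show "digraph_dist (new_amsterdam M \<alpha> \<beta> \<gamma> \<delta>) u v \<le> enat N"
    using digraph_dist_le_mod_reach[of M \<alpha> \<beta> \<gamma> \<delta> n u v] uv
    by (simp add: order_trans[of _ "enat n"])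
qed

text \<open>Every step is odd, so any first step turns an odd displacement into an even one.\<close>

lemma digraph_diameter_le_Suc:
  assumes M: "M > 0" "even M" and g: "odd g"
    and ev: "\<And>i t. even t \<Longrightarrow> \<exists>n\<le>N. mod_reach M (-1) 1 g (-g) n i (i + t)"
  shows "digraph_diameter (new_amsterdam M (-1) 1 g (-g)) \<le> enat (Suc N)"
proof (rule digraph_diameter_le_mod_reach)
  fix i t :: int
  show "\<exists>n\<le>Suc N. mod_reach M (-1) 1 g (-g) n i (i + t)"
  proof (cases "even t")
    case True
    then show ?thesis using ev le_SucI by blast
  next
    case False
    define s where "s = (if even i then 1 else g)"
    have "even (t - s)" using False g by (simp add: s_def)
    then obtain n where "n \<le> N" "mod_reach M (-1) 1 g (-g) n (i + s) (i + s + (t - s))"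
      using ev by blast
    then have "n \<le> N" "mod_reach M (-1) 1 g (-g) n (i + s) (i + t)" by auto
    then show ?thesis
      using mod_reach_Suc[OF M, of i s] by (auto simp: s_def split: if_splits)
  qed
qed

text \<open>The bounds put \<open>t\<close> out of reach of \<open>n\<close> steps from the even
  vertex 0 in either direction around the cycle. Length \<open>n + 1\<close> has the wrong parity,
  since \<open>M\<close> is even; hence the gain of 2.\<close>

lemma digraph_diameter_ge:
  fixes g t :: int
  assumes M: "even M" and g: "odd g" "g \<ge> 1"
    and par: "even t \<longleftrightarrow> even n"
    and bound: "int ((n + 1) div 2) + g * int (n div 2) < t"
      "t + (int ((n + 1) div 2) + g * int (n div 2)) < int M"
  shows "enat (n + 2) \<le> digraph_diameter (new_amsterdam M (-1) 1 g (-g))"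
proof -
  let ?G = "new_amsterdam M (-1) 1 g (-g)"
  interpret wf_digraph ?G by (rule wf_digraph_new_amsterdam)
  let ?B = "\<lambda>n. int ((n + 1) div 2) + g * int (n div 2)"
  \<comment> \<open>With \<open>bound\<close> this gives \<open>0 < t < M\<close>, so
    \<open>t\<close> is itself a vertex.\<close>
  have B0: "?B n \<ge> 0" using g(2) by simp
  have "n + 2 \<le> length p" if p: "awalk 0 p t" for p
  proof (rule ccontr)
    assume short: "\<not> n + 2 \<le> length p"
    obtain z where z: "[t = z] (mod int M)" "even z \<longleftrightarrow> even (length p)" "\<bar>z\<bar> \<le> ?B (length p)"
      using awalk_displacement_bound[OF M g p] by auto
    have dv: "int M dvd t - z" using z(1) by (simp add: cong_iff_dvd_diff)
    moreover have "2 dvd int M" using M by simp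
    ultimately have "even (t - z)" by (rule dvd_trans[rotated])
    then have "even (length p) \<longleftrightarrow> even n" using z(2) par by auto
    then have "length p \<le> n" using short by (cases "length p = Suc n") auto
    then have "?B (length p) \<le> ?B n"
      using g(2) by (intro add_mono mult_left_mono) (auto simp: div_le_mono)
    then have "0 < t - z" "t - z < int M" using z(3) bound by linarith+
    then show False using dv zdvd_not_zless by blast
  qed
  then have "enat (n + 2) \<le> digraph_dist ?G 0 t"
    unfolding digraph_dist_def by (intro INF_greatest) (auto simp: apath_def)
  also have "\<dots> \<le> digraph_diameter ?G"
    unfolding digraph_diameter_def
    by (rule SUP_upper2[of "(0, t)"]) (use bound B0 in \<open>auto simp: new_amsterdam_def\<close>)
  finally show ?thesis .
qed

section \<open>Even residues reached within a given number of steps\<close>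

lemma mod_reach_even_le:
  assumes M: "M > 0" "even M" and "even t" "\<bar>t\<bar> \<le> 2 * int k * (int k + 1)"
  shows "\<exists>n\<le>2 * k. mod_reach M (-1) 1 (2 * int k + 1) (- (2 * int k + 1)) n i (i + t)"
proof -
  obtain a x y where a: "a \<le> k" "\<bar>x\<bar> \<le> int a" "even (x - int a)" "\<bar>y\<bar> \<le> int a" "even (y - int a)"
    and t: "t = x + (2 * int k + 1) * y"
    using even_displacement_le[OF assms(3,4)] .
  have "mod_reach M (-1) 1 (2 * int k + 1) (- (2 * int k + 1)) (2 * a) i (i + t)"
    using mod_reach_even[OF M _ a(2-5), of "2 * int k + 1" i] t by (simp add: add.assoc)
  with a(1) show ?thesis by (intro exI[of _ "2 * a"]) simp
qed

lemma mod_reach_even_Suc_le: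
  assumes M: "M > 0" "even M" and "even t" "\<bar>t\<bar> \<le> 2 * (int k + 1)\<^sup>2"
  shows "\<exists>n\<le>2 * k + 2. mod_reach M (-1) 1 (2 * int k + 1) (- (2 * int k + 1)) n i (i + t)"
proof -
  obtain a x y where a: "a \<le> Suc k" "\<bar>x\<bar> \<le> int a" "even (x - int a)" "\<bar>y\<bar> \<le> int a"
    "even (y - int a)" and t: "t = x + (2 * int k + 1) * y"
    using even_displacement_Suc_le[OF assms(3,4)] .
  have "mod_reach M (-1) 1 (2 * int k + 1) (- (2 * int k + 1)) (2 * a) i (i + t)"
    using mod_reach_even[OF M _ a(2-5), of "2 * int k + 1" i] t by (simp add: add.assoc)
  with a(1) show ?thesis by (intro exI[of _ "2 * a"]) simp
qed

lemma even_centered_residue: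
  fixes t :: int
  assumes "M > 0" "even M" "even t"
  obtains r where "[t = r] (mod int M)" "2 * \<bar>r\<bar> \<le> int M" "even r"
proof -
  obtain r where r: "[t = r] (mod int M)" "2 * \<bar>r\<bar> \<le> int M"
    using centered_residue[OF assms(1)] .
  have "even r"
    using cong_dvd_iff[OF cong_dvd_modulus[OF r(1)], of 2] assms(2,3) by simp
  with r that show ?thesis by blast
qed

text \<open>Half of the largest admissible \<open>M\<close> is \<open>2(k + 1)\<^sup>2 + 1\<close>,
  which is odd, so an even centred residue stays within \<open>2(k + 1)\<^sup>2\<close>.\<close>

lemma mod_reach_even_residue_Suc:
  assumes M: "M > 0" "even M" "M \<le> 4 * (k + 1)\<^sup>2 + 2" and "even t"
  shows "\<exists>n\<le>2 * k + 2. mod_reach M (-1) 1 (2 * int k + 1) (- (2 * int k + 1)) n i (i + t)"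
proof -
  obtain r where r: "[t = r] (mod int M)" "2 * \<bar>r\<bar> \<le> int M" "even r"
    using even_centered_residue[OF M(1,2) assms(4)] .
  have "int M \<le> 4 * (int k + 1)\<^sup>2 + 2"
    using of_nat_mono[OF M(3), where 'a = int] by (simp add: add.commute)
  then have "\<bar>r\<bar> \<le> 2 * (int k + 1)\<^sup>2 + 1" using r(2) by linarith
  moreover have "\<bar>r\<bar> \<noteq> 2 * (int k + 1)\<^sup>2 + 1"
  proof
    assume "\<bar>r\<bar> = 2 * (int k + 1)\<^sup>2 + 1"
    then have "odd \<bar>r\<bar>" by simp
    with r(3) show False by simp
  qed
  ultimately have "\<bar>r\<bar> \<le> 2 * (int k + 1)\<^sup>2" by linarith
  from mod_reach_even_Suc_le[OF M(1,2) r(3) this, of i] show ?thesis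
    using mod_reach_cong[of "i + t" "i + r" M] r(1) by (simp add: cong_add_lcancel)
qed

lemma mod_reach_even_residue:
  assumes M: "M > 0" "even M" "M \<le> 4 * k\<^sup>2 + 4 * k + 4" and "even t"
    and nt: "M = 4 * k\<^sup>2 + 4 * k + 4 \<Longrightarrow> \<not> [t = 2 * (int k)\<^sup>2 + 2 * int k + 2] (mod int M)"
  shows "\<exists>n\<le>2 * k. mod_reach M (-1) 1 (2 * int k + 1) (- (2 * int k + 1)) n i (i + t)"
proof -
  \<comment> \<open>\<open>h\<close> is half of the largest admissible \<open>M\<close>. The value
    \<open>h\<close> is excluded by \<open>nt\<close> and \<open>h - 1\<close> by parity, while
    \<open>h - 2 = 2k(k + 1)\<close> is exactly the reach of \<open>2k\<close> steps.\<close>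
  define h where "h = 2 * (int k)\<^sup>2 + 2 * int k + 2"
  have h: "int (4 * k\<^sup>2 + 4 * k + 4) = 2 * h" by (simp add: h_def)
  have h2: "even h" by (simp add: h_def)
  obtain r where r: "[t = r] (mod int M)" "2 * \<bar>r\<bar> \<le> int M" "even r"
    using even_centered_residue[OF M(1,2) assms(4)] .
  have "int M \<le> 2 * h" using of_nat_mono[OF M(3), where 'a = int] h by linarith
  then have "\<bar>r\<bar> \<le> h" using r(2) by linarith
  moreover have "\<bar>r\<bar> \<noteq> h"
  proof
    assume *: "\<bar>r\<bar> = h"
    then have "int M = 2 * h" using r(2) \<open>int M \<le> 2 * h\<close> by linarith
    then have Mh: "M = 4 * k\<^sup>2 + 4 * k + 4" using h by linarith
    \<comment> \<open>Here \<open>M = 2h\<close>, so \<open>h\<close> and \<open>-h\<close> are the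
      same residue and \<open>nt\<close> excludes both signs.\<close>
    have "[r = h] (mod int M)"
    proof (cases "r \<ge> 0")
      case True
      then show ?thesis using * by simp
    next
      case False
      then have "r = h - int M" using * \<open>int M = 2 * h\<close> by simp
      then show ?thesis by (simp add: cong_iff_dvd_diff)
    qed
    then show False using nt[OF Mh] r(1) cong_trans unfolding h_def by blast
  qed
  moreover have "\<bar>r\<bar> \<noteq> h - 1"
  proof
    assume "\<bar>r\<bar> = h - 1"
    then have "odd \<bar>r\<bar>" using h2 by simp
    with r(3) show False by simp
  qed
  ultimately have "\<bar>r\<bar> \<le> h - 2" by linarith
  then have "\<bar>r\<bar> \<le> 2 * int k * (int k + 1)" by (simp add: h_def power2_eq_square algebra_simps)
  from mod_reach_even_le[OF M(1,2) r(3) this, of i] show ?thesis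
    using mod_reach_cong[of "i + t" "i + r" M] r(1) by (simp add: cong_add_lcancel)
qed

text \<open>
  For \<open>M = 4k\<^sup>2 + 4k + 4\<close> the only even displacement that needs more than \<open>2k\<close> steps is \<open>M / 2\<close>,
  and at least one of the two possible first steps of an odd displacement avoids leaving it.
\<close>

lemma digraph_diameter_le_middle:
  assumes k: "k \<ge> 1" and M: "M = 4 * k\<^sup>2 + 4 * k + 4"
  shows "digraph_diameter (new_amsterdam M (-1) 1 (2 * int k + 1) (- (2 * int k + 1)))
    \<le> enat (2 * k + 2)"
proof (rule digraph_diameter_le_mod_reach)
  fix i t :: int
  let ?R = "mod_reach M (-1) 1 (2 * int k + 1) (- (2 * int k + 1))"
  let ?h = "2 * (int k)\<^sup>2 + 2 * int k + 2"
  have M0: "M > 0" "even M" by (auto simp: M)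
  show "\<exists>n\<le>2 * k + 2. ?R n i (i + t)"
  proof (cases "even t")
    case True
    have "M \<le> 4 * (k + 1)\<^sup>2 + 2" using k by (simp add: M power2_eq_square algebra_simps)
    then show ?thesis using mod_reach_even_residue_Suc[OF M0 _ True] by blast
  next
    case False
    define c where "c = (if even i then 1 else 2 * int k + 1)"
    \<comment> \<open>If both first steps left the displacement \<open>M / 2\<close>, then
      \<open>M\<close> would divide \<open>2c\<close>; but \<open>0 < 2c < M\<close>.\<close>
    have "\<exists>s\<in>{c, - c}. \<not> [t - s = ?h] (mod int M)"
    proof (rule ccontr)
      assume "\<not> ?thesis"
      then have "[t - c = ?h] (mod int M)" "[t - (- c) = ?h] (mod int M)" by blast+
      then have "[t - (- c) = t - c] (mod int M)" using cong_sym cong_trans by blast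
      then have "int M dvd 2 * c" by (simp add: cong_iff_dvd_diff)
      moreover have "0 < 2 * c" by (simp add: c_def)
      moreover have "2 * c < int M" using k by (auto simp: c_def M add_pos_nonneg)
      ultimately show False using zdvd_not_zless by blast
    qed
    then obtain s where s: "s \<in> {c, - c}" "\<not> [t - s = ?h] (mod int M)" by blast
    have "even (t - s)" using s(1) False by (auto simp: c_def split: if_splits)
    then obtain n where n: "n \<le> 2 * k" "?R n (i + s) (i + s + (t - s))"
      using mod_reach_even_residue[OF M0, of k "t - s"] s(2) M by blast
    then have "?R n (i + s) (i + t)" by simp
    then have "?R (Suc n) i (i + t)"
      by (rule mod_reach_Suc[OF M0, rotated]) (use s(1) in \<open>auto simp: c_def split: if_splits\<close>)
    with n(1) show ?thesis by (intro exI[of _ "Suc n"]) simp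
  qed
qed

section \<open>The three ranges of \<open>M\<close>\<close>

theorem theorem4p2:
  fixes k M :: nat
  defines "D \<equiv> digraph_diameter (new_amsterdam M (- 1) 1 (2 * int k + 1) (- (2 * int k + 1)))"
  assumes "k \<ge> 1" and "even M"
  shows "(4 * k\<^sup>2 + 4 \<le> M \<and> M \<le> 4 * k\<^sup>2 + 4 * k + 2 \<longrightarrow> D = enat (2 * k + 1)) \<and>
         (M = 4 * k\<^sup>2 + 4 * k + 4 \<longrightarrow> D = enat (2 * k + 2)) \<and>
         (4 * k\<^sup>2 + 4 * k + 8 \<le> M \<and> M \<le> 4 * (k + 1)\<^sup>2 + 2 \<longrightarrow> D = enat (2 * k + 3))"
proof (intro conjI impI)
  let ?g = "2 * int k + 1"
  have g: "odd ?g" "?g \<ge> 1" by auto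
  {
    assume M: "4 * k\<^sup>2 + 4 \<le> M \<and> M \<le> 4 * k\<^sup>2 + 4 * k + 2"
    then have "M > 0" by linarith
    have "D \<le> enat (Suc (2 * k))"
      unfolding D_def
      by (rule digraph_diameter_le_Suc[OF \<open>M > 0\<close> assms(3) g(1)], rule mod_reach_even_residue)
         (use M \<open>M > 0\<close> assms(3) in auto)
    \<comment> \<open>From 0, \<open>2k - 1\<close> steps cover at most
      \<open>2k\<^sup>2 - 1\<close>; the witness \<open>2k\<^sup>2 + 1\<close> is the next odd
      number. Writing \<open>k = Suc l\<close> removes the natural subtraction.\<close>
    moreover have "enat (2 * k - 1 + 2) \<le> D"
    proof -
      obtain l where l: "k = Suc l" using assms(2) by (cases k) auto
      have "int (4 * k\<^sup>2 + 4) \<le> int M" using M by (intro of_nat_mono) simp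
      then show ?thesis
        unfolding D_def
        by (intro digraph_diameter_ge[OF assms(3) g, where t = "2 * (int k)\<^sup>2 + 1"])
           (auto simp: l power2_eq_square algebra_simps)
    qed
    ultimately show "D = enat (2 * k + 1)" using assms(2) by (auto intro: antisym)
  }
  {
    assume M: "M = 4 * k\<^sup>2 + 4 * k + 4"
    have "D \<le> enat (2 * k + 2)"
      unfolding D_def by (rule digraph_diameter_le_middle[OF assms(2) M])
    \<comment> \<open>The witness is \<open>M / 2\<close>, two more than the reach
      \<open>2k(k + 1)\<close> of \<open>2k\<close> steps.\<close>
    moreover have "enat (2 * k + 2) \<le> D"
      unfolding D_def
      by (intro digraph_diameter_ge[OF assms(3) g, where t = "2 * (int k)\<^sup>2 + 2 * int k + 2"])
         (auto simp: M power2_eq_square algebra_simps)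
    ultimately show "D = enat (2 * k + 2)" by (rule antisym)
  }
  {
    assume M: "4 * k\<^sup>2 + 4 * k + 8 \<le> M \<and> M \<le> 4 * (k + 1)\<^sup>2 + 2"
    then have "M > 0" by linarith
    have "D \<le> enat (Suc (2 * k + 2))"
      unfolding D_def
      by (rule digraph_diameter_le_Suc[OF \<open>M > 0\<close> assms(3) g(1)], rule mod_reach_even_residue_Suc)
         (use M \<open>M > 0\<close> assms(3) in auto)
    \<comment> \<open>From 0, \<open>2k + 1\<close> steps cover at most
      \<open>2k\<^sup>2 + 2k + 1\<close>; the witness is again the next number of the same
      parity.\<close>
    moreover have "enat (2 * k + 1 + 2) \<le> D"
    proof -
      have "int (4 * k\<^sup>2 + 4 * k + 8) \<le> int M" using M by (intro of_nat_mono) simp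
      then show ?thesis
        unfolding D_def
        by (intro digraph_diameter_ge[OF assms(3) g, where t = "2 * (int k)\<^sup>2 + 2 * int k + 3"])
           (auto simp: power2_eq_square algebra_simps)
    qed
    ultimately show "D = enat (2 * k + 3)" by (auto intro: antisym simp: numeral_3_eq_3)
  }
qed

end
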